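(* Assume that $\vartheta$ computing nodes are used in the Full Multigrid Scheme (defined in the context), that the nonlinear eigenvalue solving in the coarse spaces $V_{H,h_k}$ ($k=1,\dots,n$) and in $V_{h_1}$ needs work $\mathcal{O}(M_H)$ and $\mathcal{O}(M_{h_1})$ respectively, and that the work of the multigrid solver $MG(V_{h_k},\lambda^{(\ell)}_{h_k}u^{(\ell)}_{h_k}-f(x,u^{(\ell)}_{h_k}),u^{(\ell)}_{h_k},m)$ in each level space $V_{h_k}$ is $\mathcal{O}(N_k)$ for $k=2,3,\dots,n$, where $N_k=\dim V_{h_k}$. Let $\varpi$ denote the number of nonlinear iterations used when solving the nonlinear eigenvalue problem on $V_{H,h_k}$ in each correction step. Then in each computing node the work involved in the Full Multigrid Scheme satisfies $$\text{Total work}=\mathcal{O}\Big(\big(1+\tfrac{\varpi}{\vartheta}\big)N_n+M_H\log N_n+M_{h_1}\Big).$$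
   Context: **Problem.** $\Omega\subset\mathbb{R}^d$ ($d=2,3$) is a bounded Lipschitz domain, $V=H_0^1(\Omega)$, $(\cdot,\cdot)$ the $L^2(\Omega)$ inner product, $\mathcal{A}$ a symmetric positive definite matrix (function) of suitable regularity, $f(x,u)$ a function nonlinear in $u$, and $$a(u,v)=\int_\Omega(\mathcal{A}\nabla u\cdot\nabla v+f(x,u)v)\,d\Omega,\quad b(u,v)=\int_\Omega uv\,d\Omega,\quad \widehat a(w,v)=\int_\Omega\mathcal{A}\nabla w\cdot\nabla v\,d\Omega.$$ The eigenvalue problem is: find $(\lambda,u)\in\mathbb{R}\times V$ with $b(u,u)=1$ and $a(u,v)=\lambda b(u,v)$ for all $v\in V$ (simple eigenvalue case). **Spaces.** $V_H\subseteq V_{h_1}\subset\cdots\subset V_{h_n}\subset V$ are nested linear finite element spaces on a coarse mesh $\mathcal{T}_H$ and successive regular refinements $\mathcal{T}_{h_1},\dots,\mathcal{T}_{h_n}$, with mesh sizes $h_k=h_{k-1}/\beta$, $\beta>1$ (each element is divided into $\beta^d$ subelements). Hence the dimensions $N_k=\dim V_{h_k}$ satisfy $N_k\approx(1/\beta)^{d(n-k)}N_n$, $k=1,\dots,n$. **One Correction Step** $(\lambda^{(\ell+1)}_{h_k},u^{(\ell+1)}_{h_k})=EigenMG(V_H,\lambda^{(\ell)}_{h_k},u^{(\ell)}_{h_k},V_{h_k},m)$: 1. For the linear problem of finding $\widehat u\in V_{h_k}$ with $\widehat a(\widehat u,v)=(\lambda^{(\ell)}_{h_k}u^{(\ell)}_{h_k}-f(x,u^{(\ell)}_{h_k}),v)$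 for all $v\in V_{h_k}$, perform $m$ multigrid iteration steps with initial value $u^{(\ell)}_{h_k}$, giving $\widetilde u^{(\ell+1)}_{h_k}=MG(V_{h_k},\lambda^{(\ell)}_{h_k}u^{(\ell)}_{h_k}-f(x,u^{(\ell)}_{h_k}),u^{(\ell)}_{h_k},m)$. 2. Set $V_{H,h_k}=V_H+\mathrm{span}\{\widetilde u^{(\ell+1)}_{h_k}\}$ and solve the nonlinear eigenvalue problem: $(\lambda^{(\ell+1)}_{h_k},u^{(\ell+1)}_{h_k})\in\mathbb{R}\times V_{H,h_k}$, $b(u^{(\ell+1)}_{h_k},u^{(\ell+1)}_{h_k})=1$, $a(u^{(\ell+1)}_{h_k},v)=\lambda^{(\ell+1)}_{h_k}b(u^{(\ell+1)}_{h_k},v)$ for all $v\in V_{H,h_k}$, by a nonlinear iteration (self-consistent or Newton type). **Full Multigrid Scheme.** 1. Solve the nonlinear eigenvalue problem on $V_{h_1}$ for $(\lambda_{h_1},u_{h_1})$: $b(u_{h_1},u_{h_1})=1$, $a(u_{h_1},v)=\lambda_{h_1}b(u_{h_1},v)$ for all $v\in V_{h_1}$. 2. For $k=2,\dots,n$: set $\lambda^{(0)}_{h_k}=\lambda_{h_{k-1}}$, $u^{(0)}_{h_k}=u_{h_{k-1}}$; for $\ell=0,\dots,p-1$ set $(\lambda^{(\ell+1)}_{h_k},u^{(\ell+1)}_{h_k})=EigenMG(V_H,\lambda^{(\ell)}_{h_k},u^{(\ell)}_{h_k},V_{h_k},m)$; then set $\lambda_{h_k}=\lambda^{(p)}_{h_k}$,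 $u_{h_k}=u^{(p)}_{h_k}$. The output is $(\lambda_{h_n},u_{h_n})$. The numbers $m$ and $p$ are fixed (independent of $n$ and of the mesh sizes). **Work model.** In each nonlinear iteration of step 2 of the One Correction Step the matrix on $V_{H,h_k}$ ($k=2,\dots,n$) must be assembled, which costs work $\mathcal{O}(N_k)$ in total; this assembly is carried out in parallel without data transfer, so that it costs $\mathcal{O}(N_k/\vartheta)$ in each of the $\vartheta$ computing nodes. This assembly cost is counted in addition to the eigenvalue solving work $\mathcal{O}(M_H)$. *)

theory Defs
  imports
    "HOL-Analysis.Analysis"
    "HOL-Library.Function_Algebras"
    "HOL-Library.Landau_Symbols"
begin

section \<open>Landau bounds that are uniform in a secondary index\<close>

text \<open>
  The \<open>O\<close>-statements concern a family of runs of the scheme, indexed by \<open>i\<close> along a filter \<open>F\<close>,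
  and their constants do not depend on secondary indices (level, correction step, computing node)
  whose ranges \<open>X i\<close> depend on the run. They are Landau statements along the following filter.
\<close>

definition uniformly_over :: "'i filter \<Rightarrow> ('i \<Rightarrow> 'x set) \<Rightarrow> ('i \<times> 'x) filter" where
  "uniformly_over F X = inf (filtercomap fst F) (principal {(i, x). x \<in> X i})"

lemma eventually_uniformly_over:
  "eventually P (uniformly_over F X) \<longleftrightarrow> (\<forall>\<^sub>F i in F. \<forall>x\<in>X i. P (i, x))"
  unfolding uniformly_over_def eventually_inf_principal eventually_filtercomap
  by (auto elim!: eventually_mono)

lemma bigo_uniformly_over:
  "g \<in> O[uniformly_over F X](h) \<longleftrightarrow>
     (\<exists>C>0. \<forall>\<^sub>F i in F. \<forall>x\<in>X i. norm (g (i, x)) \<le> C * norm (h (i, x)))"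
  unfolding bigo_def mem_Collect_eq eventually_uniformly_over ..


section \<open>Domain, Sobolev space and coefficients\<close>

type_synonym 'd fld = "real ^ 'd \<Rightarrow> real"

text \<open>Near each boundary point the domain is the part strictly above the graph, over the hyperplane
  orthogonal to \<open>e\<close>, of a Lipschitz function.\<close>

definition bounded_lipschitz_domain :: "(real ^ 'd) set \<Rightarrow> bool" where
  "bounded_lipschitz_domain \<Omega> \<longleftrightarrow>
     \<Omega> \<noteq> {} \<and> open \<Omega> \<and> connected \<Omega> \<and> bounded \<Omega> \<and>
     (\<forall>z\<in>frontier \<Omega>. \<exists>r>0. \<exists>e L \<gamma>. norm e = 1 \<and> L-lipschitz_on UNIV \<gamma> \<and>
        \<Omega> \<inter> ball z r = {y \<in> ball z r. \<gamma> (y - (y \<bullet> e) *\<^sub>R e) < y \<bullet> e})"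

definition gradient :: "'d::finite fld \<Rightarrow> real ^ 'd \<Rightarrow> real ^ 'd" where
  "gradient \<phi> x = (\<chi> i. frechet_derivative \<phi> (at x) (axis i 1))"

primrec times_continuously_differentiable :: "nat \<Rightarrow> 'd::finite fld \<Rightarrow> bool" where
  "times_continuously_differentiable 0 \<phi> \<longleftrightarrow> continuous_on UNIV \<phi>"
| "times_continuously_differentiable (Suc k) \<phi> \<longleftrightarrow>
     (\<forall>x. \<phi> differentiable (at x)) \<and>
     (\<forall>i. times_continuously_differentiable k (\<lambda>x. gradient \<phi> x $ i))"

definition test_function :: "(real ^ 'd) set \<Rightarrow> 'd fld \<Rightarrow> bool" where
  "test_function \<Omega> \<phi> \<longleftrightarrow>
     (\<forall>k. times_continuously_differentiable k \<phi>) \<and>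
     compact (closure {x. \<phi> x \<noteq> 0}) \<and> closure {x. \<phi> x \<noteq> 0} \<subseteq> \<Omega>"

definition square_integrable :: "(real ^ 'd) set \<Rightarrow> (real ^ 'd \<Rightarrow> 'b::euclidean_space) \<Rightarrow> bool" where
  "square_integrable \<Omega> u \<longleftrightarrow>
     u \<in> borel_measurable (lebesgue_on \<Omega>) \<and> integrable (lebesgue_on \<Omega>) (\<lambda>x. (norm (u x))\<^sup>2)"

text \<open>\<open>H\<^sub>0\<^sup>1(\<Omega>)\<close> is the closure of the test functions in the \<open>H\<^sup>1\<close> norm. Its elements are represented by
  functions (not by classes modulo null sets); their values outside \<open>\<Omega>\<close> are irrelevant.\<close>

definition has_H01_gradient :: "(real ^ 'd) set \<Rightarrow> 'd fld \<Rightarrow> (real ^ 'd \<Rightarrow> real ^ 'd) \<Rightarrow> bool" where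
  "has_H01_gradient \<Omega> u g \<longleftrightarrow>
     square_integrable \<Omega> u \<and> square_integrable \<Omega> g \<and>
     (\<exists>\<phi>. (\<forall>j. test_function \<Omega> (\<phi> j)) \<and>
        (\<lambda>j. LINT x|lebesgue_on \<Omega>. (u x - \<phi> j x)\<^sup>2) \<longlonglongrightarrow> 0 \<and>
        (\<lambda>j. LINT x|lebesgue_on \<Omega>. (norm (g x - gradient (\<phi> j) x))\<^sup>2) \<longlonglongrightarrow> 0)"

definition H01 :: "(real ^ 'd) set \<Rightarrow> 'd fld set" where
  "H01 \<Omega> = {u. \<exists>g. has_H01_gradient \<Omega> u g}"

text \<open>The weak gradient; it is unique up to null sets.\<close>

definition H01_gradient :: "(real ^ 'd) set \<Rightarrow> 'd fld \<Rightarrow> real ^ 'd \<Rightarrow> real ^ 'd" where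
  "H01_gradient \<Omega> u = (SOME g. has_H01_gradient \<Omega> u g)"

text \<open>``Suitable regularity'' is what makes the forms below well defined: \<open>A\<close> is bounded and
  measurable, and \<open>f(x,u)v\<close> is integrable for all \<open>u\<close>, \<open>v\<close> in the energy space.\<close>

definition admissible_coefficients ::
  "(real ^ 'd) set \<Rightarrow> (real ^ 'd \<Rightarrow> real ^ 'd ^ 'd) \<Rightarrow> (real ^ 'd \<Rightarrow> real \<Rightarrow> real) \<Rightarrow> bool" where
  "admissible_coefficients \<Omega> A f \<longleftrightarrow>
     A \<in> borel_measurable (lebesgue_on \<Omega>) \<and> bounded (A ` \<Omega>) \<and>
     (\<forall>x\<in>\<Omega>. transpose (A x) = A x \<and> (\<forall>y. y \<noteq> 0 \<longrightarrow> 0 < y \<bullet> (A x *v y))) \<and>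
     (\<exists>x\<in>\<Omega>. \<not> linear (f x)) \<and>
     (\<forall>u\<in>H01 \<Omega>. \<forall>v\<in>H01 \<Omega>. integrable (lebesgue_on \<Omega>) (\<lambda>x. f x (u x) * v x))"

definition form_b :: "(real ^ 'd) set \<Rightarrow> 'd fld \<Rightarrow> 'd fld \<Rightarrow> real" where
  "form_b \<Omega> u v = (LINT x|lebesgue_on \<Omega>. u x * v x)"

definition form_ahat ::
  "(real ^ 'd) set \<Rightarrow> (real ^ 'd \<Rightarrow> real ^ 'd ^ 'd) \<Rightarrow> 'd fld \<Rightarrow> 'd fld \<Rightarrow> real" where
  "form_ahat \<Omega> A w v =
     (LINT x|lebesgue_on \<Omega>. (A x *v H01_gradient \<Omega> w x) \<bullet> H01_gradient \<Omega> v x)"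

definition form_a ::
  "(real ^ 'd) set \<Rightarrow> (real ^ 'd \<Rightarrow> real ^ 'd ^ 'd) \<Rightarrow> (real ^ 'd \<Rightarrow> real \<Rightarrow> real) \<Rightarrow>
    'd fld \<Rightarrow> 'd fld \<Rightarrow> real" where
  "form_a \<Omega> A f u v =
     (LINT x|lebesgue_on \<Omega>.
        (A x *v H01_gradient \<Omega> u x) \<bullet> H01_gradient \<Omega> v x + f x (u x) * v x)"

text \<open>\<open>is_eigenpair \<Omega> A f W (\<lambda>, u)\<close>: the nonlinear eigenvalue problem posed on the space \<open>W\<close>.\<close>

definition is_eigenpair ::
  "(real ^ 'd) set \<Rightarrow> (real ^ 'd \<Rightarrow> real ^ 'd ^ 'd) \<Rightarrow> (real ^ 'd \<Rightarrow> real \<Rightarrow> real) \<Rightarrow>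
    'd fld set \<Rightarrow> real \<times> 'd fld \<Rightarrow> bool" where
  "is_eigenpair \<Omega> A f W = (\<lambda>(lam, u).
     u \<in> W \<and> form_b \<Omega> u u = 1 \<and> (\<forall>v\<in>W. form_a \<Omega> A f u v = lam * form_b \<Omega> u v))"


section \<open>Meshes and linear finite element spaces\<close>

type_synonym 'd mesh = "(real ^ 'd) set set"

definition is_mesh :: "(real ^ 'd) set \<Rightarrow> 'd mesh \<Rightarrow> bool" where
  "is_mesh \<Omega> T \<longleftrightarrow>
     triangulation T \<and> (\<forall>K\<in>T. int CARD('d) simplex K) \<and> \<Union>T = closure \<Omega>"

definition mesh_size :: "'d::finite mesh \<Rightarrow> real" where
  "mesh_size T = Max (diameter ` T)"

text \<open>Finite element functions are extended by zero outside \<open>\<Omega>\<close>, so that the a.e.-ambiguity of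
  Sobolev functions is absent and the dimension is the right one.\<close>

definition fe_space :: "(real ^ 'd) set \<Rightarrow> 'd mesh \<Rightarrow> 'd fld set" where
  "fe_space \<Omega> T = {v \<in> H01 \<Omega>. continuous_on UNIV v \<and> (\<forall>x. x \<notin> \<Omega> \<longrightarrow> v x = 0) \<and>
     (\<forall>K\<in>T. \<exists>a c. \<forall>x\<in>K. v x = a \<bullet> x + c)}"

lemma vector_space_fld: "vector_space (\<lambda>(c::real) (v::'a \<Rightarrow> real) x. c * v x)"
  by unfold_locales (auto simp: fun_eq_iff algebra_simps)

definition fe_dim :: "(real ^ 'd) set \<Rightarrow> 'd mesh \<Rightarrow> nat" where
  "fe_dim \<Omega> T = vector_space.dim (\<lambda>(c::real) v x. c * v x) (fe_space \<Omega> T)"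

text \<open>Each element of the mesh \<open>T\<close> is divided into \<open>\<beta>\<^sup>d\<close> elements of the mesh \<open>T'\<close>.\<close>

definition regular_refinement :: "real \<Rightarrow> 'd::finite mesh \<Rightarrow> 'd mesh \<Rightarrow> bool" where
  "regular_refinement \<beta> T T' \<longleftrightarrow>
     (\<forall>K'\<in>T'. \<exists>K\<in>T. K' \<subseteq> K) \<and>
     (\<forall>K\<in>T. \<Union>{K' \<in> T'. K' \<subseteq> K} = K \<and> real (card {K' \<in> T'. K' \<subseteq> K}) = \<beta> ^ CARD('d)) \<and>
     mesh_size T' = mesh_size T / \<beta>"

text \<open>The first mesh \<open>T 1\<close> may be the coarse mesh \<open>TH\<close> itself or any refinement of it.\<close>

definition mesh_hierarchy ::
  "(real ^ 'd) set \<Rightarrow> real \<Rightarrow> nat \<Rightarrow> 'd mesh \<Rightarrow> (nat \<Rightarrow> 'd mesh) \<Rightarrow> bool" where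
  "mesh_hierarchy \<Omega> \<beta> n TH T \<longleftrightarrow>
     is_mesh \<Omega> TH \<and> (\<forall>k\<in>{1..n}. is_mesh \<Omega> (T k)) \<and>
     (\<forall>K'\<in>T 1. \<exists>K\<in>TH. K' \<subseteq> K) \<and>
     (\<forall>k\<in>{2..n}. regular_refinement \<beta> (T (k - 1)) (T k)) \<and>
     fe_space \<Omega> TH \<subseteq> fe_space \<Omega> (T 1) \<and>
     (\<forall>k\<in>{2..n}. fe_space \<Omega> (T (k - 1)) \<subset> fe_space \<Omega> (T k)) \<and>
     fe_space \<Omega> (T n) \<subset> H01 \<Omega>"


section \<open>The full multigrid scheme with work accounting\<close>

text \<open>
  One concrete setting of the scheme: discretization, parallelization, and the solvers used as black
  boxes together with the work they need in each computing node.
  \<^item> \<open>mg_iter V g\<close> is one multigrid iteration step on \<open>V\<close> for the linear problem with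
    right-hand side \<open>g\<close>, acting on the current approximation;
  \<^item> \<open>nl_iter W\<close> is one nonlinear (self-consistent or Newton type) iteration on \<open>W\<close>;
  \<^item> \<open>mg_work V g u m j\<close> is the work in node \<open>j\<close> of the call \<open>MG(V, g, u, m)\<close>;
  \<^item> \<open>eig_work W x j\<close> is the work in node \<open>j\<close> of the whole nonlinear eigenvalue solving on \<open>W\<close>
    with starting value \<open>x\<close>, matrix assembly excluded;
  \<^item> \<open>asm_work T W x j\<close> is the work in node \<open>j\<close> of assembling on the mesh \<open>T\<close> the matrix on \<open>W\<close>
    needed in the nonlinear iteration at the iterate \<open>x\<close>.
\<close>

record ('d::finite) scheme =
  levels :: nat
  coarse_mesh :: "'d mesh"
  mesh :: "nat \<Rightarrow> 'd mesh"
  nodes :: nat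
  nl_iters :: nat
  first_solution :: "real \<times> 'd fld"
  mg_iter :: "'d fld set \<Rightarrow> 'd fld \<Rightarrow> 'd fld \<Rightarrow> 'd fld"
  nl_iter :: "'d fld set \<Rightarrow> real \<times> 'd fld \<Rightarrow> real \<times> 'd fld"
  first_work :: "nat \<Rightarrow> real"
  mg_work :: "'d fld set \<Rightarrow> 'd fld \<Rightarrow> 'd fld \<Rightarrow> nat \<Rightarrow> nat \<Rightarrow> real"
  eig_work :: "'d fld set \<Rightarrow> real \<times> 'd fld \<Rightarrow> nat \<Rightarrow> real"
  asm_work :: "'d mesh \<Rightarrow> 'd fld set \<Rightarrow> real \<times> 'd fld \<Rightarrow> nat \<Rightarrow> real"

definition level_space :: "(real ^ 'd) set \<Rightarrow> 'd scheme \<Rightarrow> nat \<Rightarrow> 'd fld set" where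
  "level_space \<Omega> S k = fe_space \<Omega> (mesh S k)"

definition level_dim :: "(real ^ 'd) set \<Rightarrow> 'd scheme \<Rightarrow> nat \<Rightarrow> nat" where
  "level_dim \<Omega> S k = fe_dim \<Omega> (mesh S k)"

definition rhs :: "(real ^ 'd \<Rightarrow> real \<Rightarrow> real) \<Rightarrow> real \<times> 'd fld \<Rightarrow> 'd fld" where
  "rhs f = (\<lambda>(lam, u) x. lam * u x - f x (u x))"

definition MG :: "'d::finite scheme \<Rightarrow> 'd fld set \<Rightarrow> 'd fld \<Rightarrow> 'd fld \<Rightarrow> nat \<Rightarrow> 'd fld" where
  "MG S V g u m = (mg_iter S V g ^^ m) u"

text \<open>\<open>V + span {u}\<close>\<close>

definition enriched :: "'d::finite fld set \<Rightarrow> 'd fld \<Rightarrow> 'd fld set" where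
  "enriched V u = {(\<lambda>x. v x + c * u x) | v c. v \<in> V}"

text \<open>The algorithms act on states consisting of an approximate eigenpair and the work accumulated
  so far in each node (added pointwise).\<close>

type_synonym 'd state = "(real \<times> 'd fld) \<times> (nat \<Rightarrow> real)"

definition nl_step :: "'d::finite scheme \<Rightarrow> 'd mesh \<Rightarrow> 'd fld set \<Rightarrow> 'd state \<Rightarrow> 'd state" where
  "nl_step S T W = (\<lambda>(x, w). (nl_iter S W x, w + asm_work S T W x))"

definition EigenMG ::
  "(real ^ 'd) set \<Rightarrow> (real ^ 'd \<Rightarrow> real \<Rightarrow> real) \<Rightarrow> nat \<Rightarrow> 'd scheme \<Rightarrow> nat \<Rightarrow>
    'd state \<Rightarrow> 'd state" where
  "EigenMG \<Omega> f m S k = (\<lambda>((lam, u), w).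
     let V = level_space \<Omega> S k;
         g = rhs f (lam, u);
         u' = MG S V g u m;
         W = enriched (fe_space \<Omega> (coarse_mesh S)) u'
     in (nl_step S (mesh S k) W ^^ nl_iters S)
          ((lam, u'), w + mg_work S V g u m + eig_work S W (lam, u')))"

text \<open>\<open>full_multigrid \<Omega> f m p S k\<close> is the state \<open>(\<lambda>\<^bsub>h\<^sub>k\<^esub>, u\<^bsub>h\<^sub>k\<^esub>)\<close> after level \<open>k\<close> has been completed.\<close>

definition full_multigrid ::
  "(real ^ 'd) set \<Rightarrow> (real ^ 'd \<Rightarrow> real \<Rightarrow> real) \<Rightarrow> nat \<Rightarrow> nat \<Rightarrow> 'd scheme \<Rightarrow> nat \<Rightarrow> 'd state" where
  "full_multigrid \<Omega> f m p S k =
     fold (\<lambda>k. EigenMG \<Omega> f m S k ^^ p) [2..<Suc k] (first_solution S, first_work S)"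

definition total_work ::
  "(real ^ 'd) set \<Rightarrow> (real ^ 'd \<Rightarrow> real \<Rightarrow> real) \<Rightarrow> nat \<Rightarrow> nat \<Rightarrow> 'd scheme \<Rightarrow> nat \<Rightarrow> real" where
  "total_work \<Omega> f m p S j = snd (full_multigrid \<Omega> f m p S (levels S)) j"


subsection \<open>The intermediate quantities occurring in a run\<close>

text \<open>\<open>(\<lambda>\<^bsub>h\<^sub>k\<^esub>\<^sup>(\<^sup>l\<^sup>), u\<^bsub>h\<^sub>k\<^esub>\<^sup>(\<^sup>l\<^sup>))\<close>, for \<open>k \<ge> 2\<close>\<close>

definition iterate ::
  "(real ^ 'd) set \<Rightarrow> (real ^ 'd \<Rightarrow> real \<Rightarrow> real) \<Rightarrow> nat \<Rightarrow> nat \<Rightarrow> 'd scheme \<Rightarrow>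
    nat \<Rightarrow> nat \<Rightarrow> real \<times> 'd fld" where
  "iterate \<Omega> f m p S k l =
     fst ((EigenMG \<Omega> f m S k ^^ l) (full_multigrid \<Omega> f m p S (k - 1)))"

text \<open>The starting value of the nonlinear iteration, consisting of the eigenvalue \<open>\<lambda>\<^bsub>h\<^sub>k\<^esub>\<^sup>(\<^sup>l\<^sup>)\<close> and the
  function obtained by the multigrid solver.\<close>

definition nl_start ::
  "(real ^ 'd) set \<Rightarrow> (real ^ 'd \<Rightarrow> real \<Rightarrow> real) \<Rightarrow> nat \<Rightarrow> nat \<Rightarrow> 'd scheme \<Rightarrow>
    nat \<Rightarrow> nat \<Rightarrow> real \<times> 'd fld" where
  "nl_start \<Omega> f m p S k l = (let (lam, u) = iterate \<Omega> f m p S k l in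
     (lam, MG S (level_space \<Omega> S k) (rhs f (lam, u)) u m))"

text \<open>The space \<open>V\<^bsub>H,h\<^sub>k\<^esub>\<close> of the correction step \<open>l\<close> on level \<open>k\<close>.\<close>

definition correction_space ::
  "(real ^ 'd) set \<Rightarrow> (real ^ 'd \<Rightarrow> real \<Rightarrow> real) \<Rightarrow> nat \<Rightarrow> nat \<Rightarrow> 'd scheme \<Rightarrow>
    nat \<Rightarrow> nat \<Rightarrow> 'd fld set" where
  "correction_space \<Omega> f m p S k l =
     enriched (fe_space \<Omega> (coarse_mesh S)) (snd (nl_start \<Omega> f m p S k l))"

definition run_mg_work ::
  "(real ^ 'd) set \<Rightarrow> (real ^ 'd \<Rightarrow> real \<Rightarrow> real) \<Rightarrow> nat \<Rightarrow> nat \<Rightarrow> 'd scheme \<Rightarrow>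
    nat \<Rightarrow> nat \<Rightarrow> nat \<Rightarrow> real" where
  "run_mg_work \<Omega> f m p S k l j = (let (lam, u) = iterate \<Omega> f m p S k l in
     mg_work S (level_space \<Omega> S k) (rhs f (lam, u)) u m j)"

definition run_eig_work ::
  "(real ^ 'd) set \<Rightarrow> (real ^ 'd \<Rightarrow> real \<Rightarrow> real) \<Rightarrow> nat \<Rightarrow> nat \<Rightarrow> 'd scheme \<Rightarrow>
    nat \<Rightarrow> nat \<Rightarrow> nat \<Rightarrow> real" where
  "run_eig_work \<Omega> f m p S k l j =
     eig_work S (correction_space \<Omega> f m p S k l) (nl_start \<Omega> f m p S k l) j"

text \<open>The work of the assembly in the nonlinear iteration number \<open>t\<close> of that correction step.\<close>

definition run_asm_work ::
  "(real ^ 'd) set \<Rightarrow> (real ^ 'd \<Rightarrow> real \<Rightarrow> real) \<Rightarrow> nat \<Rightarrow> nat \<Rightarrow> 'd scheme \<Rightarrow>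
    nat \<Rightarrow> nat \<Rightarrow> nat \<Rightarrow> nat \<Rightarrow> real" where
  "run_asm_work \<Omega> f m p S k l t j = (let W = correction_space \<Omega> f m p S k l in
     asm_work S (mesh S k) W ((nl_iter S W ^^ t) (nl_start \<Omega> f m p S k l)) j)"


subsection \<open>Correctness of the solvers\<close>

text \<open>Multigrid steps stay in \<open>V\<close> and have the solution of the linear problem as a fixed point.\<close>

definition linear_iteration ::
  "(real ^ 'd) set \<Rightarrow> (real ^ 'd \<Rightarrow> real ^ 'd ^ 'd) \<Rightarrow> 'd fld set \<Rightarrow> 'd fld \<Rightarrow>
    ('d fld \<Rightarrow> 'd fld) \<Rightarrow> bool" where
  "linear_iteration \<Omega> A V g \<Phi> \<longleftrightarrow>
     (\<forall>u\<in>V. \<Phi> u \<in> V) \<and>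
     (\<forall>u\<in>V. (\<forall>v\<in>V. form_ahat \<Omega> A u v = form_b \<Omega> g v) \<longrightarrow> \<Phi> u = u)"

text \<open>The nonlinear problems on \<open>V\<^bsub>h\<^sub>1\<^esub>\<close> and \<open>V\<^bsub>H,h\<^sub>k\<^esub>\<close> are regarded as solved exactly by the nonlinear
  iteration.\<close>

definition full_multigrid_run ::
  "(real ^ 'd) set \<Rightarrow> (real ^ 'd \<Rightarrow> real ^ 'd ^ 'd) \<Rightarrow> (real ^ 'd \<Rightarrow> real \<Rightarrow> real) \<Rightarrow>
    real \<Rightarrow> nat \<Rightarrow> nat \<Rightarrow> 'd scheme \<Rightarrow> bool" where
  "full_multigrid_run \<Omega> A f \<beta> m p S \<longleftrightarrow>
     1 \<le> levels S \<and> 1 \<le> nodes S \<and>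
     mesh_hierarchy \<Omega> \<beta> (levels S) (coarse_mesh S) (mesh S) \<and>
     is_eigenpair \<Omega> A f (level_space \<Omega> S 1) (first_solution S) \<and>
     (\<forall>k\<in>{2..levels S}. \<forall>l<p.
        linear_iteration \<Omega> A (level_space \<Omega> S k) (rhs f (iterate \<Omega> f m p S k l))
          (mg_iter S (level_space \<Omega> S k) (rhs f (iterate \<Omega> f m p S k l))) \<and>
        is_eigenpair \<Omega> A f (correction_space \<Omega> f m p S k l) (iterate \<Omega> f m p S k (Suc l)))"

end

theory Submission
  imports Defs
begin

text \<open>
  The work in a node is the initial work plus a sum over levels and correction steps. As the
  dimensions decay geometrically from the finest level downwards, the terms proportional to
  \<open>N\<^sub>k\<close> add up to \<open>O(N\<^sub>n)\<close>. The terms proportional to \<open>M\<^sub>H\<close> are counted by the number of levels,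
  and this number is \<open>O(log N\<^sub>n)\<close> because the coarsest level space has dimension at least 1.
\<close>

lemma nl_step_funpow:
  "fst ((nl_step S T W ^^ r) (x, w)) = (nl_iter S W ^^ r) x"
  "snd ((nl_step S T W ^^ r) (x, w)) j = w j + (\<Sum>t<r. asm_work S T W ((nl_iter S W ^^ t) x) j)"
proof (induction r)
  case (Suc r)
  {
    case 1
    show ?case using Suc(1) by (simp add: nl_step_def case_prod_beta)
  next
    case 2
    show ?case using Suc by (simp add: nl_step_def case_prod_beta)
  }
qed simp_all

definition step_work ::
  "(real ^ 'd) set \<Rightarrow> (real ^ 'd \<Rightarrow> real \<Rightarrow> real) \<Rightarrow> nat \<Rightarrow> nat \<Rightarrow> 'd scheme \<Rightarrow>
    nat \<Rightarrow> nat \<Rightarrow> nat \<Rightarrow> real" where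
  "step_work \<Omega> f m p S k l j =
     run_mg_work \<Omega> f m p S k l j + run_eig_work \<Omega> f m p S k l j
     + (\<Sum>t<nl_iters S. run_asm_work \<Omega> f m p S k l t j)"

text \<open>The accumulated work is only ever added to and never influences the eigenpair, so the
  increment of step \<open>l'\<close> is determined by \<open>iterate\<close> alone. The starting
  state is fixed because \<open>iterate\<close> is defined from the completed level
  \<open>k - 1\<close>.\<close>

lemma snd_EigenMG_funpow:
  "snd ((EigenMG \<Omega> f m S k ^^ l) (full_multigrid \<Omega> f m p S (k - 1))) j =
     snd (full_multigrid \<Omega> f m p S (k - 1)) j + (\<Sum>l'<l. step_work \<Omega> f m p S k l' j)"
proof (induction l)
  case (Suc l)
  obtain lam u w where s:
    "(EigenMG \<Omega> f m S k ^^ l) (full_multigrid \<Omega> f m p S (k - 1)) = ((lam, u), w)"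
    by (metis surj_pair)
  have "iterate \<Omega> f m p S k l = (lam, u)"
    unfolding iterate_def s by simp
  then have "snd (EigenMG \<Omega> f m S k ((lam, u), w)) j = w j + step_work \<Omega> f m p S k l j"
    by (simp add: EigenMG_def Let_def nl_step_funpow step_work_def run_mg_work_def
        run_eig_work_def run_asm_work_def correction_space_def nl_start_def)
  \<comment> \<open>\<open>simp\<close> turns \<open>k - 1\<close> into \<open>k - Suc 0\<close>, so
    the equation for the state has to be brought into that form to fire.\<close>
  with Suc show ?case by (simp add: s[unfolded One_nat_def])
qed simp

lemma full_multigrid_Suc:
  assumes "1 \<le> k"
  shows "full_multigrid \<Omega> f m p S (Suc k) =
           (EigenMG \<Omega> f m S (Suc k) ^^ p) (full_multigrid \<Omega> f m p S k)"
proof -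
  have "[2..<Suc (Suc k)] = [2..<Suc k] @ [Suc k]" using assms by simp
  then show ?thesis unfolding full_multigrid_def by simp
qed

lemma snd_full_multigrid:
  assumes "1 \<le> k"
  shows "snd (full_multigrid \<Omega> f m p S k) j =
           first_work S j + (\<Sum>k'=2..k. \<Sum>l<p. step_work \<Omega> f m p S k' l j)"
  using assms
proof (induction k rule: dec_induct)
  case base
  show ?case by (simp add: full_multigrid_def)
next
  case (step k)
  have "snd (full_multigrid \<Omega> f m p S (Suc k)) j =
      snd (full_multigrid \<Omega> f m p S k) j + (\<Sum>l<p. step_work \<Omega> f m p S (Suc k) l j)"
    using snd_EigenMG_funpow[where \<Omega> = \<Omega> and f = f and m = m and S = S and p = p and j = j
        and l = p and k = "Suc k"]
    by (simp add: full_multigrid_Suc[OF step.hyps(1)])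
  with step show ?case by simp
qed

text \<open>Counted from the top level, the bounds form a geometric series in \<open>q\<close>,
  which gives a factor independent of both \<open>r\<close> and \<open>n\<close>.\<close>

lemma sum_le_geometric_decay:
  fixes a :: "nat \<Rightarrow> real"
  assumes q: "0 < q" "q < 1" and "0 \<le> C" "0 \<le> X"
    and decay: "\<And>k. k \<in> {r..n} \<Longrightarrow> a k \<le> C * (q ^ (n - k) * X)"
  shows "(\<Sum>k=r..n. a k) \<le> C / (1 - q) * X"
proof -
  \<comment> \<open>Adding the nonnegative terms below \<open>r\<close> makes the range complete, so
    that reversing it yields a standard geometric sum.\<close>
  have "(\<Sum>k=r..n. q ^ (n - k)) \<le> (\<Sum>k\<le>n. q ^ (n - k))"
    by (rule sum_mono2) (use q in auto)
  also have "\<dots> = (\<Sum>k\<le>n. q ^ k)"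
    using sum.nat_diff_reindex[of "\<lambda>k. q ^ k" "Suc n"] by (simp add: lessThan_Suc_atMost)
  also have "\<dots> = (1 - q ^ Suc n) / (1 - q)"
    using q by (subst sum_gp0) auto
  also have "\<dots> \<le> 1 / (1 - q)"
    using q by (intro divide_right_mono) auto
  finally have g: "(\<Sum>k=r..n. q ^ (n - k)) \<le> 1 / (1 - q)" .
  have "(\<Sum>k=r..n. a k) \<le> (\<Sum>k=r..n. C * (q ^ (n - k) * X))"
    by (intro sum_mono decay)
  also have "\<dots> = C * X * (\<Sum>k=r..n. q ^ (n - k))"
    by (simp add: sum_distrib_left mult_ac)
  also have "\<dots> \<le> C * X * (1 / (1 - q))"
    using assms g by (intro mult_left_mono) auto
  finally show ?thesis by simp
qed

text \<open>Taking logarithms bounds \<open>r * ln b\<close> by \<open>ln C + ln X\<close>. Since X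
  \<ge> 2, the constant \<open>ln C\<close> is at most a fixed multiple of \<open>ln X\<close>,
  which leaves a purely multiplicative bound.\<close>

lemma exponent_le_ln:
  fixes b C X :: real
  assumes "1 < b" "0 < C" "2 \<le> X" "b ^ r \<le> C * X"
  shows "real r \<le> (\<bar>ln C\<bar> / ln 2 + 1) / ln b * ln X"
proof -
  have "real r * ln b = ln (b ^ r)"
    using assms by (simp add: ln_realpow)
  also have "\<dots> \<le> ln (C * X)"
    using assms by (subst ln_le_cancel_iff) auto
  also have "\<dots> = ln C + ln X"
    using assms by (simp add: ln_mult)
  also have "\<dots> \<le> \<bar>ln C\<bar> / ln 2 * ln X + ln X"
  proof -
    have "ln 2 \<le> ln X" using assms by simp
    then have "\<bar>ln C\<bar> / ln 2 * ln 2 \<le> \<bar>ln C\<bar> / ln 2 * ln X"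
      by (intro mult_left_mono) auto
    then show ?thesis by simp
  qed
  finally have "real r * ln b \<le> (\<bar>ln C\<bar> / ln 2 + 1) * ln X"
    by (simp add: algebra_simps)
  then show ?thesis
    using assms by (simp add: field_simps)
qed

text \<open>Merges the separate constants of four nonnegative contributions into the single constant
  that a Landau bound requires.\<close>

lemma le_sum_weights_mult:
  fixes a b c d w x y z :: real
  assumes "0 \<le> a" "0 \<le> b" "0 \<le> c" "0 \<le> d" "0 \<le> w" "0 \<le> x" "0 \<le> y" "0 \<le> z"
  shows "a * w + b * x + c * y + d * z \<le> (a + b + c + d) * (w + x + y + z)"
proof -
  have "a * w \<le> a * (w + x + y + z)" "b * x \<le> b * (w + x + y + z)"
    "c * y \<le> c * (w + x + y + z)" "d * z \<le> d * (w + x + y + z)"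
    using assms by (auto intro!: mult_left_mono)
  then show ?thesis by (simp only: distrib_right)
qed

theorem theorem3p3:
  fixes \<Omega> :: "(real ^ 'd) set"
    and A :: "real ^ 'd \<Rightarrow> real ^ 'd ^ 'd"
    and f :: "real ^ 'd \<Rightarrow> real \<Rightarrow> real"
    and \<beta> :: real and m p :: nat
    and F :: "'i filter" and S :: "'i \<Rightarrow> 'd scheme"
    and M_H M_h1 :: "'i \<Rightarrow> real"
  defines "n \<equiv> \<lambda>i. levels (S i)"
    and "N \<equiv> \<lambda>i k. real (level_dim \<Omega> (S i) k)"
    and "\<theta> \<equiv> \<lambda>i. nodes (S i)"
    and "\<omega> \<equiv> \<lambda>i. nl_iters (S i)"
  assumes "CARD('d) \<in> {2, 3}"
    and "bounded_lipschitz_domain \<Omega>"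
    and "admissible_coefficients \<Omega> A f"
    and "1 < \<beta>"
    and "\<And>i. full_multigrid_run \<Omega> A f \<beta> m p (S i)"
    and dims: "(\<lambda>(i, k). N i k) \<in> \<Theta>[uniformly_over F (\<lambda>i. {1..n i})](
                 \<lambda>(i, k). (1 / \<beta>) ^ (CARD('d) * (n i - k)) * N i (n i))"
    and dim_ge_2: "\<forall>\<^sub>F i in F. 2 \<le> N i (n i)"
    and nonneg: "\<And>i. 0 \<le> M_H i" "\<And>i. 0 \<le> M_h1 i"
    and first: "(\<lambda>(i, j). first_work (S i) j) \<in> O[uniformly_over F (\<lambda>i. {..<\<theta> i})](
                 \<lambda>(i, j). M_h1 i)"
    and mg: "(\<lambda>(i, k, l, j). run_mg_work \<Omega> f m p (S i) k l j)
               \<in> O[uniformly_over F (\<lambda>i. {2..n i} \<times> {..<p} \<times> {..<\<theta> i})](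
                 \<lambda>(i, k, l, j). N i k)"
    and eig: "(\<lambda>(i, k, l, j). run_eig_work \<Omega> f m p (S i) k l j)
               \<in> O[uniformly_over F (\<lambda>i. {2..n i} \<times> {..<p} \<times> {..<\<theta> i})](
                 \<lambda>(i, k, l, j). M_H i)"
    and asm: "(\<lambda>(i, k, l, t, j). run_asm_work \<Omega> f m p (S i) k l t j)
               \<in> O[uniformly_over F (\<lambda>i. {2..n i} \<times> {..<p} \<times> {..<\<omega> i} \<times> {..<\<theta> i})](
                 \<lambda>(i, k, l, t, j). N i k / real (\<theta> i))"
  shows "(\<lambda>(i, j). total_work \<Omega> f m p (S i) j) \<in> O[uniformly_over F (\<lambda>i. {..<\<theta> i})](
                 \<lambda>(i, j). (1 + real (\<omega> i) / real (\<theta> i)) * N i (n i)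
                     + M_H i * ln (N i (n i)) + M_h1 i)"
proof -
  \<comment> \<open>Up to constants, \<open>q\<close> is the factor by which the dimension shrinks
    from one level to the next coarser one.\<close>
  define q where "q = (1 / \<beta>) ^ CARD('d)"
  have q: "0 < q" "q < 1"
    using \<open>1 < \<beta>\<close> by (auto simp: q_def power_one_over power_less_one_iff)
  have n1: "1 \<le> n i" for i
    using assms(9)[of i] by (auto simp: full_multigrid_run_def n_def)
  from dims have up: "(\<lambda>(i, k). N i k) \<in> O[uniformly_over F (\<lambda>i. {1..n i})](
        \<lambda>(i, k). (1 / \<beta>) ^ (CARD('d) * (n i - k)) * N i (n i))"
    and lo: "(\<lambda>(i, k). (1 / \<beta>) ^ (CARD('d) * (n i - k)) * N i (n i))
        \<in> O[uniformly_over F (\<lambda>i. {1..n i})](\<lambda>(i, k). N i k)"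
    by (auto simp: bigtheta_def bigomega_iff_bigo)
  have N0: "0 \<le> N i k" for i k by (simp add: N_def)
  obtain C where C: "0 < C"
    and up': "\<forall>\<^sub>F i in F. \<forall>k\<in>{1..n i}. N i k \<le> C * (q ^ (n i - k) * N i (n i))"
    using up \<open>1 < \<beta>\<close> by (auto simp: bigo_uniformly_over q_def power_mult N_def abs_mult)
  obtain B where
    lo': "\<forall>\<^sub>F i in F. \<forall>k\<in>{1..n i}. q ^ (n i - k) * N i (n i) \<le> B * N i k"
    using lo \<open>1 < \<beta>\<close> by (auto simp: bigo_uniformly_over q_def power_mult N_def abs_mult)
  obtain C\<^sub>0 where C\<^sub>0: "0 < C\<^sub>0"
    and first': "\<forall>\<^sub>F i in F. \<forall>j<\<theta> i. \<bar>first_work (S i) j\<bar> \<le> C\<^sub>0 * M_h1 i"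
    using first nonneg by (auto simp: bigo_uniformly_over Ball_def)
  obtain C\<^sub>1 where C\<^sub>1: "0 < C\<^sub>1"
    and mg': "\<forall>\<^sub>F i in F. \<forall>k l j. 2 \<le> k \<and> k \<le> n i \<and> l < p \<and> j < \<theta> i \<longrightarrow>
        \<bar>run_mg_work \<Omega> f m p (S i) k l j\<bar> \<le> C\<^sub>1 * N i k"
    using mg N0 by (auto simp: bigo_uniformly_over Ball_def)
  obtain C\<^sub>2 where C\<^sub>2: "0 < C\<^sub>2"
    and eig': "\<forall>\<^sub>F i in F. \<forall>k l j. 2 \<le> k \<and> k \<le> n i \<and> l < p \<and> j < \<theta> i \<longrightarrow>
        \<bar>run_eig_work \<Omega> f m p (S i) k l j\<bar> \<le> C\<^sub>2 * M_H i"
    using eig nonneg by (auto simp: bigo_uniformly_over Ball_def)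
  obtain C\<^sub>3 where C\<^sub>3: "0 < C\<^sub>3"
    and asm': "\<forall>\<^sub>F i in F. \<forall>k l t j. 2 \<le> k \<and> k \<le> n i \<and> l < p \<and> t < \<omega> i \<and> j < \<theta> i \<longrightarrow>
        \<bar>run_asm_work \<Omega> f m p (S i) k l t j\<bar> \<le> C\<^sub>3 * (N i k / real (\<theta> i))"
    using asm N0 by (auto simp: bigo_uniformly_over Ball_def)
  \<comment> \<open>\<open>G\<close> bounds the sum of the dimensions relative to
    \<open>N i (n i)\<close>, and \<open>K\<close> bounds the number of corrected levels relative to
    \<open>ln (N i (n i))\<close>. The summands of \<open>D\<close> belong, in order, to multigrid,
    assembly, coarse eigenvalue solving and the first level; \<open>p\<close> counts the correction
    steps per level.\<close>
  define G where "G = C / (1 - q)"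
  define K where "K = (\<bar>ln C\<bar> / ln 2 + 1) / ln (1 / q)"
  define D where "D = p * C\<^sub>1 * G + p * C\<^sub>3 * G + p * C\<^sub>2 * K + C\<^sub>0"
  have GK: "0 \<le> G" "0 \<le> K"
    using C q by (auto simp: G_def K_def)
  \<comment> \<open>Strictness comes from \<open>C\<^sub>0\<close>, as the other summands vanish for
    p = 0.\<close>
  then have "0 < D"
    using C\<^sub>0 C\<^sub>1 C\<^sub>2 C\<^sub>3 unfolding D_def by (intro add_nonneg_pos) auto
  moreover have "\<forall>\<^sub>F i in F. \<forall>j<\<theta> i. \<bar>total_work \<Omega> f m p (S i) j\<bar> \<le>
      D * \<bar>(1 + real (\<omega> i) / real (\<theta> i)) * N i (n i) + M_H i * ln (N i (n i)) + M_h1 i\<bar>"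
    using up' lo' first' mg' eig' asm' dim_ge_2
  proof eventually_elim
    case (elim i)
    have N2: "2 \<le> N i (n i)" using elim(7) .
    have dim_sum: "(\<Sum>k=2..n i. N i k) \<le> G * N i (n i)"
      unfolding G_def using q C N0 elim(1) by (intro sum_le_geometric_decay) auto
    \<comment> \<open>The lower half of the \<Theta>-bound excludes dimension 0 on level 1. Being a
      natural number, that dimension is then at least 1, and the upper half at level 1 turns this
      into a bound on \<open>(1 / q) ^ (n i - 1)\<close>.\<close>
    have "0 < q ^ (n i - 1) * N i (n i)"
      using q N2 by simp
    also have "\<dots> \<le> B * N i 1"
      using elim(2) n1 by simp
    finally have "N i 1 \<noteq> 0" by auto
    then have "1 \<le> N i 1" by (simp add: N_def)
    also have "\<dots> \<le> C * (q ^ (n i - 1) * N i (n i))"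
      using elim(1) n1 by simp
    finally have "(1 / q) ^ (n i - 1) \<le> C * N i (n i)"
      using q by (simp add: power_one_over field_simps)
    then have levels: "real (n i - 1) \<le> K * ln (N i (n i))"
      unfolding K_def using q C N2 by (intro exponent_le_ln) auto
    show ?case
    proof (intro allI impI)
      fix j assume j: "j < \<theta> i"
      define w where "w = real (\<omega> i) / real (\<theta> i)"
      have w: "0 \<le> w" by (simp add: w_def)
      have step: "\<bar>step_work \<Omega> f m p (S i) k l j\<bar> \<le> (C\<^sub>1 + C\<^sub>3 * w) * N i k + C\<^sub>2 * M_H i"
        if "k \<in> {2..n i}" "l < p" for k l
      proof -
        \<comment> \<open>Each of the \<open>\<omega> i\<close> assemblies costs a multiple of
          \<open>N i k / \<theta> i\<close>; together they produce the factor
          \<open>w\<close>.\<close>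
        have "\<bar>\<Sum>t<\<omega> i. run_asm_work \<Omega> f m p (S i) k l t j\<bar>
            \<le> (\<Sum>t<\<omega> i. C\<^sub>3 * (N i k / real (\<theta> i)))"
          using elim(6) that j by (intro order_trans[OF sum_abs] sum_mono) auto
        also have "\<dots> = C\<^sub>3 * w * N i k" by (simp add: w_def)
        finally have "\<bar>\<Sum>t<\<omega> i. run_asm_work \<Omega> f m p (S i) k l t j\<bar> \<le> C\<^sub>3 * w * N i k" .
        moreover have "\<bar>run_mg_work \<Omega> f m p (S i) k l j\<bar> \<le> C\<^sub>1 * N i k"
          "\<bar>run_eig_work \<Omega> f m p (S i) k l j\<bar> \<le> C\<^sub>2 * M_H i"
          using elim(4,5) that j by auto
        ultimately show ?thesis
          unfolding step_work_def \<omega>_def distrib_right by linarith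
      qed
      have "\<bar>\<Sum>k=2..n i. \<Sum>l<p. step_work \<Omega> f m p (S i) k l j\<bar>
          \<le> (\<Sum>k=2..n i. \<Sum>l<p. (C\<^sub>1 + C\<^sub>3 * w) * N i k + C\<^sub>2 * M_H i)"
        using step by (intro order_trans[OF sum_abs] sum_mono) auto
      \<comment> \<open>The range from 2 to \<open>n i\<close> has \<open>n i - 1\<close> members,
        exactly the exponent bounded in \<open>levels\<close>.\<close>
      also have "\<dots> = p * ((C\<^sub>1 + C\<^sub>3 * w) * (\<Sum>k=2..n i. N i k) + C\<^sub>2 * M_H i * real (n i - 1))"
        by (simp add: sum.distrib flip: sum_distrib_left)
      also have "\<dots> \<le> p * ((C\<^sub>1 + C\<^sub>3 * w) * (G * N i (n i)) + C\<^sub>2 * M_H i * (K * ln (N i (n i))))"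
        using dim_sum levels w C\<^sub>1 C\<^sub>2 C\<^sub>3 nonneg by (intro mult_left_mono add_mono) auto
      finally have sums: "\<bar>\<Sum>k=2..n i. \<Sum>l<p. step_work \<Omega> f m p (S i) k l j\<bar> \<le> \<dots>" .
      have "total_work \<Omega> f m p (S i) j =
          first_work (S i) j + (\<Sum>k=2..n i. \<Sum>l<p. step_work \<Omega> f m p (S i) k l j)"
        using n1[of i] by (simp add: total_work_def n_def snd_full_multigrid)
      moreover have "\<bar>first_work (S i) j\<bar> \<le> C\<^sub>0 * M_h1 i"
        using elim(3) j by simp
      ultimately have "\<bar>total_work \<Omega> f m p (S i) j\<bar> \<le> C\<^sub>0 * M_h1 i +
          p * ((C\<^sub>1 + C\<^sub>3 * w) * (G * N i (n i)) + C\<^sub>2 * M_H i * (K * ln (N i (n i))))"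
        using sums by linarith
      \<comment> \<open>Regrouped so that the four coefficients are the summands of
        \<open>D\<close>.\<close>
      also have "\<dots> = p * C\<^sub>1 * G * N i (n i) + p * C\<^sub>3 * G * (w * N i (n i)) +
          p * C\<^sub>2 * K * (M_H i * ln (N i (n i))) + C\<^sub>0 * M_h1 i"
        by (simp add: algebra_simps)
      also have "\<dots> \<le> D * (N i (n i) + w * N i (n i) + M_H i * ln (N i (n i)) + M_h1 i)"
        unfolding D_def using C\<^sub>0 C\<^sub>1 C\<^sub>2 C\<^sub>3 GK w N2 nonneg by (intro le_sum_weights_mult) auto
      \<comment> \<open>Passing to the absolute value, which is the norm in the Landau bound, can
        only enlarge the right-hand side.\<close>
      also have "\<dots> \<le> D * \<bar>(1 + w) * N i (n i) + M_H i * ln (N i (n i)) + M_h1 i\<bar>"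
        using \<open>0 < D\<close> by (intro mult_left_mono) (auto simp: distrib_right)
      finally show "\<bar>total_work \<Omega> f m p (S i) j\<bar> \<le> D * \<bar>(1 + real (\<omega> i) / real (\<theta> i)) * N i (n i)
          + M_H i * ln (N i (n i)) + M_h1 i\<bar>"
        unfolding w_def .
    qed
  qed
  ultimately show ?thesis
    by (auto simp: bigo_uniformly_over Ball_def)
qed

end
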